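(* Let $m,n\ge1$ and let $A_j,B_j$ ($1\le j\le m$) be $n\times n$ complex positive definite matrices. Then \begin{align*} \Big(\sum_{j=1}^{m}(A_j\sharp B_j)\Big)\circ\Big(\sum_{j=1}^{m}(A_j\sharp B_j)\Big) &\le\Big(\sum_{j=1}^{m}(A_j\sharp_sB_j)\Big)\circ\Big(\sum_{j=1}^{m}(A_j\sharp_{1-s}B_j)\Big)\\ &\le\Big(\sum_{j=1}^{m}(A_j\sharp_tB_j)\Big)\circ\Big(\sum_{j=1}^{m}(A_j\sharp_{1-t}B_j)\Big)\\ &\le\Big(\sum_{j=1}^{m}A_j\Big)\circ\Big(\sum_{j=1}^{m}B_j\Big) \end{align*} whenever $0\le t\le s\le\frac12$ or $\frac12\le s\le t\le1$.
   Context: $\circ$ is the Hadamard (entrywise) product of matrices, and $\le$ is the Loewner order on Hermitian matrices ($X\le Y$ iff $Y-X$ is positive semidefinite). For positive definite $A,B$ and $0\le p\le1$, $A\sharp_pB=A^{1/2}(A^{-1/2}BA^{-1/2})^{p}A^{1/2}$ and $A\sharp B=A\sharp_{1/2}B$. *)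

theory Defs
  imports "HOL-Analysis.Analysis"
begin

definition conj_transpose :: "complex ^ 'n ^ 'm \<Rightarrow> complex ^ 'm ^ 'n"
  where "conj_transpose A = (\<chi> i j. cnj (A $ j $ i))"

definition hermitian :: "complex ^ 'n ^ 'n \<Rightarrow> bool"
  where "hermitian A \<longleftrightarrow> conj_transpose A = A"

definition unitary :: "complex ^ 'n ^ 'n \<Rightarrow> bool"
  where "unitary U \<longleftrightarrow> conj_transpose U ** U = mat 1 \<and> U ** conj_transpose U = mat 1"

definition quad_form :: "complex ^ 'n ^ 'n \<Rightarrow> complex ^ 'n \<Rightarrow> complex"
  where "quad_form A x = (\<Sum>i\<in>UNIV. cnj (x $ i) * (A *v x) $ i)"

text \<open>The quadratic form of a Hermitian matrix is real-valued, so taking the real part below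
  loses no information.\<close>

definition pos_semidef :: "complex ^ 'n ^ 'n \<Rightarrow> bool"
  where "pos_semidef A \<longleftrightarrow> hermitian A \<and> (\<forall>x. 0 \<le> Re (quad_form A x))"

definition pos_def :: "complex ^ 'n ^ 'n \<Rightarrow> bool"
  where "pos_def A \<longleftrightarrow> hermitian A \<and> (\<forall>x. x \<noteq> 0 \<longrightarrow> 0 < Re (quad_form A x))"

definition loewner_le :: "complex ^ 'n ^ 'n \<Rightarrow> complex ^ 'n ^ 'n \<Rightarrow> bool"  (infix "\<le>\<^sub>L" 50)
  where "X \<le>\<^sub>L Y \<longleftrightarrow> hermitian X \<and> hermitian Y \<and> pos_semidef (Y - X)"

definition hadamard :: "complex ^ 'n ^ 'm \<Rightarrow> complex ^ 'n ^ 'm \<Rightarrow> complex ^ 'n ^ 'm"  (infixl "\<odot>" 70)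
  where "A \<odot> B = (\<chi> i j. A $ i $ j * B $ i $ j)"

definition real_diag :: "('n \<Rightarrow> real) \<Rightarrow> complex ^ 'n ^ 'n"
  where "real_diag d = (\<chi> i j. if i = j then complex_of_real (d i) else 0)"

text \<open>The functional calculus \<open>f(A) = U diag(f(d\<^sub>1), \<dots>, f(d\<^sub>n)) U\<^sup>*\<close> for any spectral decomposition
  \<open>A = U diag(d\<^sub>1, \<dots>, d\<^sub>n) U\<^sup>*\<close> with \<open>U\<close> unitary and real \<open>d\<^sub>i\<close>.  A decomposition exists exactly when
  \<open>A\<close> is Hermitian, and \<open>f(A)\<close> does not depend on the chosen one; for other \<open>A\<close> the value is
  unspecified.\<close>

definition matrix_fun :: "(real \<Rightarrow> real) \<Rightarrow> complex ^ 'n ^ 'n \<Rightarrow> complex ^ 'n ^ 'n"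
  where "matrix_fun f A = (THE X. \<exists>U d. unitary U \<and> A = U ** real_diag d ** conj_transpose U
           \<and> X = U ** real_diag (\<lambda>i. f (d i)) ** conj_transpose U)"

text \<open>Only meant for positive definite \<open>A\<close>, where all eigenvalues are positive and \<open>powr\<close> is the
  usual real power (in particular \<open>x powr 0 = 1\<close>).\<close>

definition matrix_powr :: "complex ^ 'n ^ 'n \<Rightarrow> real \<Rightarrow> complex ^ 'n ^ 'n"
  where "matrix_powr A p = matrix_fun (\<lambda>x. x powr p) A"

definition wgeo_mean :: "complex ^ 'n ^ 'n \<Rightarrow> real \<Rightarrow> complex ^ 'n ^ 'n \<Rightarrow> complex ^ 'n ^ 'n"
    (\<open>_ \<sharp>\<^bsub>_\<^esub> _\<close> [76, 0, 76] 75)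
  where "A \<sharp>\<^bsub>p\<^esub> B =
    matrix_powr A (1/2)
      ** matrix_powr (matrix_powr A (-1/2) ** B ** matrix_powr A (-1/2)) p
      ** matrix_powr A (1/2)"

abbreviation geo_mean :: "complex ^ 'n ^ 'n \<Rightarrow> complex ^ 'n ^ 'n \<Rightarrow> complex ^ 'n ^ 'n"
    (\<open>_ \<sharp> _\<close> [76, 76] 75)
  where "A \<sharp> B \<equiv> A \<sharp>\<^bsub>1/2\<^esub> B"

end

theory Submission
  imports Defs
begin

text \<open>For positive definite \<open>A\<close> and \<open>B\<close> there are a matrix \<open>C\<close> and positive numbers \<open>d\<^sub>1, \<dots>, d\<^sub>n\<close> such
  that \<open>A \<sharp>\<^sub>p B = C diag(d\<^sub>1\<^sup>p, \<dots>, d\<^sub>n\<^sup>p) C\<^sup>*\<close> for every \<open>p\<close>, including \<open>A\<close> at \<open>p = 0\<close> and \<open>B\<close> at \<open>p = 1\<close>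
  (\<open>wgeo_mean_congruence\<close>).  Written through the columns of the matrices \<open>C\<^sub>j\<close>, the sum of the means
  \<open>A\<^sub>j \<sharp>\<^sub>p B\<^sub>j\<close> is a sum of rank-one matrices \<open>w\<^sub>i\<^sup>p c\<^sub>i c\<^sub>i\<^sup>*\<close> in which neither the vectors \<open>c\<^sub>i\<close> nor the positive
  numbers \<open>w\<^sub>i\<close> depend on \<open>p\<close>.

  The quadratic form of the Hadamard product of these sums for the exponents \<open>p\<close> and \<open>1 - p\<close> is then
  \<open>\<Sum>\<^sub>i\<^sub>k w\<^sub>i\<^sup>p w\<^sub>k\<^sup>1\<^sup>-\<^sup>p N\<^sub>i\<^sub>k\<close> with \<open>N\<^sub>i\<^sub>k \<ge> 0\<close>, and \<open>N\<^sub>i\<^sub>k = N\<^sub>k\<^sub>i\<close> because the Hadamard product of vectors is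
  commutative.  Symmetrising, only \<open>w\<^sub>i\<^sup>p w\<^sub>k\<^sup>1\<^sup>-\<^sup>p + w\<^sub>k\<^sup>p w\<^sub>i\<^sup>1\<^sup>-\<^sup>p\<close> matters, and this scalar
  grows as \<open>p\<close> moves away from \<open>1/2\<close> (\<open>powr_interpolation_le\<close>).  So the whole Hadamard product grows in the
  Loewner order (\<open>weighted_gram_hadamard_mono\<close>), and the theorem compares the exponents \<open>1/2\<close>, \<open>s\<close>, \<open>t\<close>
  and \<open>0\<close>.

  The analytic input is the spectral theorem for Hermitian matrices
  (\<open>hermitian_spectral_decomposition\<close>), proved by maximising quadratic forms over spheres of
  real subspaces, together with the independence of the functional calculus of the decomposition
  (\<open>matrix_fun_spectral\<close>).\<close>

section \<open>Self-adjoint operators on a real Euclidean space\<close>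

text \<open>A maximiser \<open>u\<close> of the quadratic form on the unit sphere of \<open>W\<close>, with maximum \<open>l\<close>, is an
  eigenvector.  The form \<open>l \<parallel>y\<parallel>\<^sup>2 - y \<bullet> f y\<close> is nonnegative on \<open>W\<close> and vanishes at \<open>u\<close>, so its
  first-order term at \<open>u\<close> in the direction \<open>r = l u - f u\<close>, namely \<open>2 \<parallel>r\<parallel>\<^sup>2\<close>, must be zero.
  Restricting to an invariant subspace allows eigenvectors to be split off one at a time.\<close>

lemma self_adjoint_eigenvector_in_invariant_subspace:
  fixes f :: "'a::euclidean_space \<Rightarrow> 'a"
  assumes lin: "linear f" and adj: "\<And>x y. f x \<bullet> y = x \<bullet> f y"
    and W: "subspace W" "f ` W \<subseteq> W" and nz: "z \<in> W" "z \<noteq> 0"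
  obtains u l where "u \<in> W" "norm u = 1" "f u = l *\<^sub>R u"
proof -
  have comp: "compact (sphere 0 1 \<inter> W)"
    by (intro compact_Int_closed closed_subspace W compact_sphere)
  have "(1 / norm z) *\<^sub>R z \<in> sphere 0 1 \<inter> W"
    using nz W by (simp add: subspace_scale)
  then have ne: "sphere 0 1 \<inter> W \<noteq> {}" by blast
  have cont: "continuous_on (sphere 0 1 \<inter> W) (\<lambda>x. x \<bullet> f x)"
    using lin by (intro continuous_intros linear_continuous_on) (simp add: linear_conv_bounded_linear)
  obtain u where u: "u \<in> sphere 0 1 \<inter> W"
    and umax: "\<And>y. y \<in> sphere 0 1 \<inter> W \<Longrightarrow> y \<bullet> f y \<le> u \<bullet> f u"
    using continuous_attains_sup[OF comp ne cont] by blast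
  define l where "l = u \<bullet> f u"
  have uW: "u \<in> W" and n1: "norm u = 1" and uu: "u \<bullet> u = 1"
    using u by (auto simp: dot_square_norm)
  have bound: "y \<bullet> f y \<le> l * (y \<bullet> y)" if "y \<in> W" for y
  proof (cases "y = 0")
    case True then show ?thesis by simp
  next
    case False
    have "(1 / norm y) *\<^sub>R y \<bullet> f ((1 / norm y) *\<^sub>R y) \<le> l"
      unfolding l_def using False that W by (intro umax) (simp add: subspace_scale)
    then have "(y \<bullet> f y) / (norm y)\<^sup>2 \<le> l"
      by (simp add: linear_scale[OF lin] power2_eq_square)
    then show ?thesis
      using False by (simp add: dot_square_norm pos_divide_le_eq)
  qed
  define r where "r = l *\<^sub>R u - f u"
  have rW: "r \<in> W"
    unfolding r_def using uW W by (intro subspace_diff subspace_scale) auto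
  define a c where "a = r \<bullet> r" and "c = l * (r \<bullet> r) - r \<bullet> f r"
  have c0: "c \<ge> 0" using bound[OF rW] by (simp add: c_def)
  \<comment> \<open>Moving from \<open>u\<close> to \<open>u + t r\<close> changes the form by \<open>2 t a + t\<^sup>2 c\<close>; this choice of \<open>t\<close> makes the
    change equal to \<open>- t\<^sup>2 (c + 2)\<close>, with \<open>c + 1\<close> in the denominator because \<open>c\<close> may be zero.\<close>
  define t where "t = - a / (c + 1)"
  have "0 \<le> l * ((u + t *\<^sub>R r) \<bullet> (u + t *\<^sub>R r)) - (u + t *\<^sub>R r) \<bullet> f (u + t *\<^sub>R r)"
    using bound[of "u + t *\<^sub>R r"] uW rW W by (simp add: subspace_add subspace_scale)
  also have "\<dots> = (l * (u \<bullet> u) - u \<bullet> f u) + 2 * t * (l * (u \<bullet> r) - f u \<bullet> r) + t\<^sup>2 * c"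
    using adj[of u r] adj[of r u]
    by (simp add: linear_add[OF lin] linear_scale[OF lin] c_def algebra_simps inner_commute power2_eq_square)
  also have "\<dots> = 2 * t * a + t\<^sup>2 * c"
    by (simp add: uu l_def a_def r_def inner_diff_left)
  also have "\<dots> = - (t\<^sup>2 * (c + 2))"
  proof -
    have "a = - t * (c + 1)" using c0 by (simp add: t_def)
    then show ?thesis by (subst (1) \<open>a = - t * (c + 1)\<close>) (simp add: algebra_simps power2_eq_square)
  qed
  finally have "t\<^sup>2 * (c + 2) \<le> 0" by simp
  then have "t = 0" using c0 by (simp add: mult_le_0_iff)
  then have "a = 0" using c0 by (simp add: t_def)
  then have "f u = l *\<^sub>R u" by (simp add: a_def r_def)
  then show ?thesis using that uW n1 by blast
qed

section \<open>Matrices as real-linear operators\<close>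

text \<open>The Euclidean inner product on \<open>complex ^ 'n\<close> is the real part of the Hermitian one.  The
  lemmas below express conjugate transposes and quadratic forms through it, so that Hermitian matrices
  become self-adjoint operators on a real Euclidean space.\<close>

lemma linear_mv: "linear ((*v) (A :: complex ^ 'n ^ 'm))"
  by simp

lemma quad_form_inner: "Re (quad_form A x) = x \<bullet> (A *v x)"
  by (simp add: quad_form_def inner_vec_def inner_complex_def)

lemma conj_transpose_inner: "(A *v x) \<bullet> y = x \<bullet> (conj_transpose A *v y)"
proof -
  have "Re (\<Sum>i\<in>UNIV. \<Sum>j\<in>UNIV. cnj (A $ i $ j * x $ j) * y $ i)
      = Re (\<Sum>j\<in>UNIV. \<Sum>i\<in>UNIV. cnj (A $ i $ j * x $ j) * y $ i)"
    by (subst sum.swap) simp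
  then show ?thesis
    by (simp add: inner_vec_def inner_complex_def matrix_vector_mult_def conj_transpose_def
      sum_distrib_left sum_distrib_right algebra_simps sum.distrib sum_subtractf)
qed

lemma conj_transpose_mult: "conj_transpose (A ** B) = conj_transpose B ** conj_transpose A"
  by (simp add: conj_transpose_def matrix_matrix_mult_def vec_eq_iff mult.commute)

lemma conj_transpose_real_diag [simp]: "conj_transpose (real_diag d) = real_diag d"
  by (simp add: conj_transpose_def real_diag_def vec_eq_iff)

lemma conj_transpose_idem [simp]: "conj_transpose (conj_transpose A) = A"
  by (simp add: conj_transpose_def vec_eq_iff)

lemma mult_real_diag_nth: "(A ** real_diag d) $ i $ j = A $ i $ j * complex_of_real (d j)"
  by (simp add: matrix_matrix_mult_def real_diag_def if_distrib cong: if_cong)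

lemma real_diag_mult_nth: "(real_diag d ** A) $ i $ j = complex_of_real (d i) * A $ i $ j"
  by (simp add: matrix_matrix_mult_def real_diag_def if_distrib if_distribR cong: if_cong)

lemma real_diag_mult: "real_diag d ** real_diag e = real_diag (\<lambda>i. d i * e i)"
  by (simp add: vec_eq_iff mult_real_diag_nth) (simp add: real_diag_def)

lemma real_diag_one: "real_diag (\<lambda>i. 1) = mat 1"
  by (simp add: real_diag_def mat_def vec_eq_iff)

section \<open>Spectral decomposition and functional calculus\<close>

text \<open>The imaginary part of the Hermitian product of \<open>x\<close> and \<open>y\<close> is \<open>- (x \<bullet> (\<i> *s y))\<close>; complex
  orthogonality therefore means real orthogonality to both \<open>y\<close> and \<open>\<i> *s y\<close>, and this lemma makes
  that condition symmetric.\<close>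

lemma imag_scale_inner: "(\<i> *s x) \<bullet> y = - (x \<bullet> (\<i> *s y))"
  for x y :: "complex ^ 'n"
  by (simp add: inner_vec_def inner_complex_def sum_negf[symmetric] algebra_simps)

text \<open>Eigenvectors are found one index at a time.  The vectors orthogonal, in the complex sense, to
  those already found form an invariant real subspace.  It is nonzero because at most \<open>2 |S|\<close> real
  conditions are imposed on a space of real dimension \<open>2 n\<close>, and so it contains a further
  eigenvector.  Indexing by subsets of the index type keeps the dimension out of the induction.\<close>

lemma hermitian_orthonormal_eigenvectors:
  fixes A :: "complex ^ 'n ^ 'n" and S :: "'n set"
  assumes "hermitian A"
  shows "\<exists>v d. \<forall>i\<in>S. norm (v i) = 1 \<and> A *v v i = d i *\<^sub>R v i \<and>
    (\<forall>j\<in>S. j \<noteq> i \<longrightarrow> v i \<bullet> v j = 0 \<and> v i \<bullet> (\<i> *s v j) = 0)"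
  using finite[of S]
proof (induction S rule: finite_induct)
  case empty
  then show ?case by simp
next
  case (insert k S)
  then obtain v d where v: "\<And>i. i \<in> S \<Longrightarrow> norm (v i) = 1"
    "\<And>i. i \<in> S \<Longrightarrow> A *v v i = d i *\<^sub>R v i"
    "\<And>i j. i \<in> S \<Longrightarrow> j \<in> S \<Longrightarrow> j \<noteq> i \<Longrightarrow> v i \<bullet> v j = 0 \<and> v i \<bullet> (\<i> *s v j) = 0"
    by blast
  have adj: "(A *v x) \<bullet> y = x \<bullet> (A *v y)" for x y
    using assms by (simp add: conj_transpose_inner hermitian_def)
  define T where "T = v ` S \<union> (\<lambda>i. \<i> *s v i) ` S"
  define W where "W = {x. \<forall>y\<in>T. orthogonal y x}"
  have W: "subspace W"
    unfolding W_def by (auto simp: subspace_def orthogonal_clauses)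
  have W_iff: "x \<in> W \<longleftrightarrow> (\<forall>i\<in>S. x \<bullet> v i = 0 \<and> x \<bullet> (\<i> *s v i) = 0)" for x
    by (auto simp: W_def T_def orthogonal_def inner_commute)
  have "card S < CARD('n)"
    using insert.hyps by (metis UNIV_I finite psubset_card_mono subset_UNIV psubsetI)
  moreover have "card T \<le> card S + card S"
    unfolding T_def
    by (rule order_trans[OF card_Un_le]) (intro add_mono card_image_le insert.hyps)
  moreover have "dim T \<le> card T"
    by (intro dim_le_card') (simp add: T_def insert.hyps)
  ultimately have "dim T < DIM(complex ^ 'n)" by simp
  then obtain z where "z \<noteq> 0" "\<And>y. y \<in> span T \<Longrightarrow> orthogonal z y"
    using orthogonal_to_subspace_exists by blast
  then have z: "z \<noteq> 0" "z \<in> W" by (auto simp: W_def span_base orthogonal_commute)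
  have AW: "(*v) A ` W \<subseteq> W"
  proof clarify
    fix x assume x: "x \<in> W"
    show "A *v x \<in> W"
      unfolding W_iff
    proof (intro ballI conjI)
      fix i assume i: "i \<in> S"
      then show "(A *v x) \<bullet> v i = 0"
        using x v(2)[OF i] by (simp add: adj W_iff)
      have "A *v (\<i> *s v i) = d i *\<^sub>R (\<i> *s v i)"
        using v(2)[OF i] by (simp add: vector_scalar_commute vec_eq_iff)
      then show "(A *v x) \<bullet> (\<i> *s v i) = 0"
        using x i by (simp add: adj W_iff)
    qed
  qed
  obtain u l where u: "u \<in> W" "norm u = 1" "A *v u = l *\<^sub>R u"
    by (rule self_adjoint_eigenvector_in_invariant_subspace[OF linear_mv adj W AW z(2,1)])
  define v' where "v' = v(k := u)"
  define d' where "d' = d(k := l)"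
  have old: "v' i = v i" "d' i = d i" if "i \<in> S" for i
    using that insert.hyps by (auto simp: v'_def d'_def)
  have new: "v' k = u" "d' k = l" by (simp_all add: v'_def d'_def)
  have uv: "u \<bullet> v i = 0" "u \<bullet> (\<i> *s v i) = 0" "v i \<bullet> u = 0" "v i \<bullet> (\<i> *s u) = 0"
    if "i \<in> S" for i
    using u(1) that imag_scale_inner[of "v i" u] by (auto simp: W_iff inner_commute)
  have "\<forall>i\<in>insert k S. norm (v' i) = 1 \<and> A *v v' i = d' i *\<^sub>R v' i \<and>
    (\<forall>j\<in>insert k S. j \<noteq> i \<longrightarrow> v' i \<bullet> v' j = 0 \<and> v' i \<bullet> (\<i> *s v' j) = 0)"
    using v u uv by (auto simp: old new)
  then show ?case by blast
qed

theorem hermitian_spectral_decomposition: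
  fixes A :: "complex ^ 'n ^ 'n"
  assumes "hermitian A"
  obtains U d where "unitary U" "A = U ** real_diag d ** conj_transpose U"
proof -
  obtain v :: "'n \<Rightarrow> complex ^ 'n" and d where v: "\<And>i. norm (v i) = 1" "\<And>i. A *v v i = d i *\<^sub>R v i"
    "\<And>i j. j \<noteq> i \<Longrightarrow> v i \<bullet> v j = 0" "\<And>i j. j \<noteq> i \<Longrightarrow> v i \<bullet> (\<i> *s v j) = 0"
    using hermitian_orthonormal_eigenvectors[OF assms, of UNIV] by auto
  define U where "U = (\<chi> p i. v i $ p)"
  have re: "v i \<bullet> v j = (if i = j then 1 else 0)" for i j
    using v(1,3) by (simp add: dot_square_norm)
  have im: "v i \<bullet> (\<i> *s v j) = 0" for i j
    using v(4)[of j i] imag_scale_inner[of "v i" "v i"] by (cases "i = j") (auto simp: inner_commute)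
  have "(conj_transpose U ** U) $ i $ j = (mat 1 :: complex ^ 'n ^ 'n) $ i $ j" for i j
  proof (rule complex_eqI)
    show "Re ((conj_transpose U ** U) $ i $ j) = Re ((mat 1 :: complex ^ 'n ^ 'n) $ i $ j)"
      using re[of i j]
      by (simp add: conj_transpose_def matrix_matrix_mult_def U_def mat_def inner_vec_def inner_complex_def
        split: if_splits)
    show "Im ((conj_transpose U ** U) $ i $ j) = Im ((mat 1 :: complex ^ 'n ^ 'n) $ i $ j)"
      using im[of i j]
      by (simp add: conj_transpose_def matrix_matrix_mult_def U_def mat_def inner_vec_def inner_complex_def
        sum.distrib sum_subtractf sum_negf)
  qed
  then have 1: "conj_transpose U ** U = mat 1" by (simp add: vec_eq_iff)
  then have 2: "U ** conj_transpose U = mat 1" using matrix_left_right_inverse by blast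
  have "(A ** U) $ p $ i = (U ** real_diag d) $ p $ i" for p i
  proof -
    have "(A ** U) $ p $ i = (A *v v i) $ p"
      by (simp add: matrix_matrix_mult_def matrix_vector_mult_def U_def)
    also have "\<dots> = (U ** real_diag d) $ p $ i"
      by (simp only: v(2) vector_scaleR_component)
        (simp add: mult_real_diag_nth U_def scaleR_conv_of_real mult.commute)
    finally show ?thesis .
  qed
  then have "A ** U = U ** real_diag d" by (simp add: vec_eq_iff)
  then have "A = U ** real_diag d ** conj_transpose U"
    using 2 by (metis matrix_mul_assoc matrix_mul_rid)
  then show ?thesis using that 1 2 by (simp add: unitary_def)
qed

text \<open>The functional calculus is independent of the decomposition.  If \<open>U D U\<^sup>* = V E V\<^sup>*\<close>, the change
  of basis \<open>M = V\<^sup>* U\<close> satisfies \<open>M D = E M\<close>, so that an entry of \<open>M\<close> can be nonzero only where the two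
  eigenvalues agree; then \<open>M f(D) = f(E) M\<close> as well.\<close>

lemma matrix_fun_spectral:
  assumes U: "unitary U"
  shows "matrix_fun f (U ** real_diag d ** conj_transpose U)
    = U ** real_diag (\<lambda>i. f (d i)) ** conj_transpose U"
  unfolding matrix_fun_def
proof (rule the_equality)
  show "\<exists>V e. unitary V \<and> U ** real_diag d ** conj_transpose U = V ** real_diag e ** conj_transpose V
    \<and> U ** real_diag (\<lambda>i. f (d i)) ** conj_transpose U
      = V ** real_diag (\<lambda>i. f (e i)) ** conj_transpose V"
    using U by blast
next
  fix X
  assume "\<exists>V e. unitary V \<and> U ** real_diag d ** conj_transpose U = V ** real_diag e ** conj_transpose V
    \<and> X = V ** real_diag (\<lambda>i. f (e i)) ** conj_transpose V"
  then obtain V e where V: "unitary V"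
    and eq: "U ** real_diag d ** conj_transpose U = V ** real_diag e ** conj_transpose V"
    and X: "X = V ** real_diag (\<lambda>i. f (e i)) ** conj_transpose V" by blast
  note UU = U[unfolded unitary_def] and VV = V[unfolded unitary_def]
  define M where "M = conj_transpose V ** U"
  have "M ** real_diag d = conj_transpose V ** (U ** real_diag d ** conj_transpose U) ** U"
    using UU by (simp add: M_def flip: matrix_mul_assoc)
  also have "\<dots> = real_diag e ** M"
    unfolding eq M_def using VV by (simp add: matrix_mul_assoc)
  finally have "M $ i $ j * complex_of_real (d j) = complex_of_real (e i) * M $ i $ j" for i j
    by (metis mult_real_diag_nth real_diag_mult_nth)
  then have "M $ i $ j = 0 \<or> d j = e i" for i j
    by (metis mult.commute mult_cancel_right of_real_eq_iff)
  then have fM: "M ** real_diag (\<lambda>i. f (d i)) = real_diag (\<lambda>i. f (e i)) ** M"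
    unfolding vec_eq_iff mult_real_diag_nth real_diag_mult_nth by (metis mult.commute mult_zero_left)
  have "X = V ** real_diag (\<lambda>i. f (e i)) ** M ** conj_transpose U"
    using UU by (simp add: X M_def flip: matrix_mul_assoc)
  also have "\<dots> = V ** (M ** real_diag (\<lambda>i. f (d i))) ** conj_transpose U"
    by (simp only: fM matrix_mul_assoc)
  also have "\<dots> = U ** real_diag (\<lambda>i. f (d i)) ** conj_transpose U"
    using VV by (simp add: M_def matrix_mul_assoc)
  finally show "X = U ** real_diag (\<lambda>i. f (d i)) ** conj_transpose U" .
qed

lemma pos_def_spectral_decomposition:
  fixes A :: "complex ^ 'n ^ 'n"
  assumes "pos_def A"
  obtains U d where "unitary U" "A = U ** real_diag d ** conj_transpose U" "\<And>i. 0 < d i"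
proof -
  obtain U d where U: "unitary U" and A: "A = U ** real_diag d ** conj_transpose U"
    using assms hermitian_spectral_decomposition by (metis pos_def_def)
  have UU: "conj_transpose U ** U = mat 1" using U by (simp add: unitary_def)
  have "0 < d i" for i
  proof -
    let ?u = "U *v axis i 1"
    have Uu: "conj_transpose U *v ?u = axis i 1"
      by (simp add: matrix_vector_mul_assoc UU)
    then have "?u \<noteq> 0" by (metis axis_eq_0_iff matrix_vector_mult_0_right zero_neq_one)
    then have "0 < ?u \<bullet> (A *v ?u)"
      using assms by (simp add: pos_def_def quad_form_inner)
    also have "A *v ?u = U *v (real_diag d *v axis i 1)"
      by (simp add: A Uu flip: matrix_vector_mul_assoc)
    also have "?u \<bullet> \<dots> = axis i 1 \<bullet> (real_diag d *v axis i 1)"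
      by (metis Uu conj_transpose_inner conj_transpose_idem inner_commute)
    also have "\<dots> = d i"
    proof -
      have "real_diag d *v axis i 1 = of_real (d i) *s axis i 1"
        by (simp add: vec_eq_iff matrix_vector_mult_def real_diag_def axis_def)
           (simp add: if_distrib if_distribR cong: if_cong)
      then show ?thesis by (simp add: inner_axis')
    qed
    finally show ?thesis .
  qed
  with U A that show ?thesis by blast
qed

section \<open>Weighted geometric means\<close>

text \<open>Positive definite \<open>A\<close> and \<open>B\<close> are simultaneously diagonalised by a congruence: if
  \<open>A\<^sup>-\<^sup>1\<^sup>/\<^sup>2 B A\<^sup>-\<^sup>1\<^sup>/\<^sup>2 = V D V\<^sup>*\<close>, take \<open>C = A\<^sup>1\<^sup>/\<^sup>2 V\<close>.  The point is that \<open>C\<close> does not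
  depend on \<open>p\<close>, so the exponent enters the weighted means only through the scalars \<open>d i powr p\<close>.\<close>

lemma wgeo_mean_congruence:
  fixes A B :: "complex ^ 'n ^ 'n"
  assumes "pos_def A" "pos_def B"
  obtains C :: "complex ^ 'n ^ 'n" and d
  where "\<And>i. 0 < d i" "A = C ** conj_transpose C"
    "B = C ** real_diag d ** conj_transpose C"
    "\<And>p. A \<sharp>\<^bsub>p\<^esub> B = C ** real_diag (\<lambda>i. d i powr p) ** conj_transpose C"
proof -
  obtain U a where U: "unitary U" and A: "A = U ** real_diag a ** conj_transpose U"
    and a: "\<And>i. 0 < a i"
    using pos_def_spectral_decomposition[OF assms(1)] by blast
  have UU: "conj_transpose U ** U = mat 1" "U ** conj_transpose U = mat 1"
    using U by (auto simp: unitary_def)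
  define R where "R = matrix_powr A (1/2)"
  define S where "S = matrix_powr A (-1/2)"
  have pw: "matrix_powr A p = U ** real_diag (\<lambda>i. a i powr p) ** conj_transpose U" for p
    unfolding matrix_powr_def A by (rule matrix_fun_spectral[OF U])
  have herm: "conj_transpose (matrix_powr A p) = matrix_powr A p" for p
    by (simp add: pw conj_transpose_mult matrix_mul_assoc)
  have mult: "matrix_powr A p ** matrix_powr A q = matrix_powr A (p + q)" for p q
  proof -
    have "matrix_powr A p ** matrix_powr A q
      = U ** real_diag (\<lambda>i. a i powr p) ** (conj_transpose U ** U) ** real_diag (\<lambda>i. a i powr q)
        ** conj_transpose U"
      by (simp only: pw matrix_mul_assoc)
    also have "\<dots> = U ** (real_diag (\<lambda>i. a i powr p) ** real_diag (\<lambda>i. a i powr q)) ** conj_transpose U"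
      by (simp add: UU matrix_mul_assoc)
    finally show ?thesis by (simp add: real_diag_mult pw powr_add)
  qed
  have p1: "matrix_powr A 1 = A" using a by (subst (2) A) (simp add: pw less_imp_le)
  have p0: "matrix_powr A 0 = mat 1"
  proof -
    have "(\<lambda>i. a i powr 0) = (\<lambda>i. 1)" using a by (auto simp: less_le)
    then show ?thesis by (simp add: pw real_diag_one UU)
  qed
  have RR: "R ** R = A" and RS: "R ** S = mat 1" and SR: "S ** R = mat 1"
    by (simp_all add: R_def S_def mult p0 p1)
  have Rh: "conj_transpose R = R" and Sh: "conj_transpose S = S"
    by (simp_all add: R_def S_def herm)
  have "pos_def (S ** B ** S)"
    unfolding pos_def_def
  proof (intro conjI allI impI)
    show "hermitian (S ** B ** S)"
      using assms(2) by (simp add: hermitian_def pos_def_def conj_transpose_mult Sh matrix_mul_assoc)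
    fix x :: "complex ^ 'n" assume "x \<noteq> 0"
    moreover have "R *v (S *v x) = x" by (simp add: matrix_vector_mul_assoc RS)
    ultimately have "S *v x \<noteq> 0" by (metis matrix_vector_mult_0_right)
    then have "0 < (S *v x) \<bullet> (B *v (S *v x))"
      using assms(2) by (simp add: pos_def_def quad_form_inner)
    also have "\<dots> = x \<bullet> (S ** B ** S *v x)"
      by (simp add: conj_transpose_inner Sh matrix_vector_mul_assoc matrix_mul_assoc)
    finally show "0 < Re (quad_form (S ** B ** S) x)" by (simp add: quad_form_inner)
  qed
  then obtain V d where V: "unitary V" and VB: "S ** B ** S = V ** real_diag d ** conj_transpose V"
    and d: "\<And>i. 0 < d i"
    using pos_def_spectral_decomposition by blast
  have VV: "V ** conj_transpose V = mat 1" using V by (auto simp: unitary_def)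
  define C where "C = R ** V"
  have Ct: "conj_transpose C = conj_transpose V ** R" by (simp add: C_def conj_transpose_mult Rh)
  have "C ** conj_transpose C = R ** (V ** conj_transpose V) ** R"
    unfolding Ct by (simp only: C_def matrix_mul_assoc)
  then have 1: "A = C ** conj_transpose C" by (simp add: VV RR)
  have "C ** real_diag d ** conj_transpose C = R ** (V ** real_diag d ** conj_transpose V) ** R"
    unfolding Ct by (simp only: C_def matrix_mul_assoc)
  also have "\<dots> = (R ** S) ** B ** (S ** R)"
    by (simp only: VB[symmetric] matrix_mul_assoc)
  finally have 2: "B = C ** real_diag d ** conj_transpose C" by (simp add: RS SR)
  have 3: "A \<sharp>\<^bsub>p\<^esub> B = C ** real_diag (\<lambda>i. d i powr p) ** conj_transpose C" for p
  proof -
    have "A \<sharp>\<^bsub>p\<^esub> B = R ** matrix_powr (S ** B ** S) p ** R"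
      by (simp add: wgeo_mean_def R_def S_def)
    also have "matrix_powr (S ** B ** S) p = V ** real_diag (\<lambda>i. d i powr p) ** conj_transpose V"
      unfolding VB matrix_powr_def by (rule matrix_fun_spectral[OF V])
    finally show ?thesis unfolding Ct by (simp only: C_def matrix_mul_assoc)
  qed
  show ?thesis by (rule that[where C = C and d = d]) (fact d 1 2 3)+
qed

section \<open>Interpolation between two powers\<close>

text \<open>The right side minus the left side factors as
  \<open>x\<^sup>t y\<^sup>t (x\<^sup>s\<^sup>-\<^sup>t - y\<^sup>s\<^sup>-\<^sup>t) (x\<^sup>1\<^sup>-\<^sup>s\<^sup>-\<^sup>t - y\<^sup>1\<^sup>-\<^sup>s\<^sup>-\<^sup>t)\<close>.
  The hypothesis says that \<open>s\<close> is at least as close to \<open>1/2\<close> as \<open>t\<close> is.  The two exponents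
  \<open>s - t\<close> and \<open>1 - s - t\<close> then have the same sign, hence so do the two differences.\<close>

lemma powr_interpolation_le:
  fixes x y s t :: real
  assumes "0 < x" "0 < y" "0 \<le> (s - t) * (1 - s - t)"
  shows "x powr s * y powr (1 - s) + y powr s * x powr (1 - s)
       \<le> x powr t * y powr (1 - t) + y powr t * x powr (1 - t)"
proof -
  have same_sign: "0 \<le> (x powr p - y powr p) * (x powr q - y powr q)" if "0 \<le> p * q" for p q
  proof -
    have mono: "z powr r \<le> w powr r" if "0 \<le> r" "0 < z" "z \<le> w" for z w r :: real
      using that by (simp add: powr_mono2)
    have anti: "w powr r \<le> z powr r" if "r \<le> 0" "0 < z" "z \<le> w" for z w r :: real
      using that by (simp add: powr_mono2')
    show ?thesis
      using that assms(1,2) mono[of p x y] mono[of p y x] mono[of q x y] mono[of q y x]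
        anti[of p x y] anti[of p y x] anti[of q x y] anti[of q y x]
      by (cases "x \<le> y") (auto simp: zero_le_mult_iff)
  qed
  have split: "z powr s = z powr t * z powr (s - t)"
    "z powr (1 - s) = z powr t * z powr (1 - s - t)"
    "z powr (1 - t) = z powr t * (z powr (s - t) * z powr (1 - s - t))" if "0 < z" for z
    using that by (simp_all add: powr_add[symmetric])
  have "0 \<le> (x powr t * y powr t) *
      ((x powr (s - t) - y powr (s - t)) * (x powr (1 - s - t) - y powr (1 - s - t)))"
    using same_sign[OF assms(3)] by simp
  also have "\<dots> = (x powr t * y powr (1 - t) + y powr t * x powr (1 - t))
      - (x powr s * y powr (1 - s) + y powr s * x powr (1 - s))"
    unfolding split[OF assms(1)] split[OF assms(2)] by (simp add: algebra_simps)
  finally show ?thesis by simp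
qed

section \<open>Hadamard products of sums of rank-one matrices\<close>

text \<open>The sum of the rank-one matrices \<open>w\<^sub>i c\<^sub>i c\<^sub>i\<^sup>*\<close>.  A free index set lets a whole sum of
  congruences \<open>C\<^sub>j diag(d\<^sub>j) C\<^sub>j\<^sup>*\<close> be one such matrix, indexed by pairs of \<open>j\<close> and a column.\<close>

definition weighted_gram :: "'i set \<Rightarrow> ('i \<Rightarrow> real) \<Rightarrow> ('i \<Rightarrow> complex ^ 'n) \<Rightarrow> complex ^ 'n ^ 'n"
  where "weighted_gram I w c =
    (\<chi> p q. \<Sum>i\<in>I. complex_of_real (w i) * (c i $ p * cnj (c i $ q)))"

lemma hermitian_weighted_gram_hadamard:
  "hermitian (weighted_gram I w c \<odot> weighted_gram J v e)"
  by (simp add: hermitian_def conj_transpose_def weighted_gram_def hadamard_def vec_eq_iff mult.commute)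

lemma sum_swap_pairs:
  "(\<Sum>p\<in>P. \<Sum>q\<in>Q. \<Sum>i\<in>I. \<Sum>j\<in>J. g p q i j) = (\<Sum>i\<in>I. \<Sum>j\<in>J. \<Sum>p\<in>P. \<Sum>q\<in>Q. g p q i j)"
proof -
  have "(\<Sum>p\<in>P. \<Sum>q\<in>Q. \<Sum>i\<in>I. \<Sum>j\<in>J. g p q i j) = (\<Sum>p\<in>P. \<Sum>i\<in>I. \<Sum>j\<in>J. \<Sum>q\<in>Q. g p q i j)"
    by (intro sum.cong refl trans[OF sum.swap] sum.swap)
  also have "\<dots> = (\<Sum>i\<in>I. \<Sum>j\<in>J. \<Sum>p\<in>P. \<Sum>q\<in>Q. g p q i j)"
    by (subst sum.swap) (intro sum.cong refl sum.swap)
  finally show ?thesis .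
qed

text \<open>The Hadamard product of \<open>c\<^sub>i c\<^sub>i\<^sup>*\<close> and \<open>e\<^sub>j e\<^sub>j\<^sup>*\<close> is again of rank one, given by the entrywise
  product of \<open>c\<^sub>i\<close> and \<open>e\<^sub>j\<close>.\<close>

lemma quad_form_weighted_gram_hadamard:
  fixes c e :: "'i \<Rightarrow> complex ^ 'n"
  shows "quad_form (weighted_gram I w c \<odot> weighted_gram J v e) x
    = (\<Sum>i\<in>I. \<Sum>j\<in>J. complex_of_real (w i * v j *
        (cmod (\<Sum>p\<in>UNIV. cnj (x $ p) * (c i $ p * e j $ p)))\<^sup>2))"
proof -
  define z where "z i j p = cnj (x $ p) * (c i $ p * e j $ p)" for i j p
  have "quad_form (weighted_gram I w c \<odot> weighted_gram J v e) x
    = (\<Sum>p\<in>UNIV. \<Sum>q\<in>UNIV. \<Sum>i\<in>I. \<Sum>j\<in>J. complex_of_real (w i * v j) * (z i j p * cnj (z i j q)))"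
    by (simp add: quad_form_def matrix_vector_mult_def hadamard_def weighted_gram_def z_def
        sum_product sum_distrib_left sum_distrib_right algebra_simps)
  also have "\<dots> = (\<Sum>i\<in>I. \<Sum>j\<in>J. \<Sum>p\<in>UNIV. \<Sum>q\<in>UNIV. complex_of_real (w i * v j) * (z i j p * cnj (z i j q)))"
    by (rule sum_swap_pairs)
  also have "\<dots> = (\<Sum>i\<in>I. \<Sum>j\<in>J. complex_of_real (w i * v j) *
      ((\<Sum>p\<in>UNIV. z i j p) * cnj (\<Sum>p\<in>UNIV. z i j p)))"
    by (simp only: cnj_sum sum_product) (simp only: sum_distrib_left)
  also have "\<dots> = (\<Sum>i\<in>I. \<Sum>j\<in>J. complex_of_real (w i * v j * (cmod (\<Sum>p\<in>UNIV. z i j p))\<^sup>2))"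
    by (simp only: of_real_mult complex_norm_square)
  finally show ?thesis by (simp add: z_def)
qed

text \<open>The quadratic form is a sum over pairs \<open>(i, j)\<close> of the weight \<open>w\<^sub>i\<^sup>s w\<^sub>j\<^sup>1\<^sup>-\<^sup>s\<close> times a nonnegative
  coefficient.  Because the Hadamard product is commutative and both factors use the same vectors, the
  coefficient is symmetric in \<open>i\<close> and \<open>j\<close>.  The weights may thus be averaged over the swap of \<open>i\<close> and \<open>j\<close>,
  and the averaged weights are compared one by one.\<close>

lemma weighted_gram_hadamard_mono:
  fixes c :: "'i \<Rightarrow> complex ^ 'n"
  assumes w: "\<And>i. i \<in> I \<Longrightarrow> 0 < w i" and st: "0 \<le> (s - t) * (1 - s - t)"
  shows "weighted_gram I (\<lambda>i. w i powr s) c \<odot> weighted_gram I (\<lambda>i. w i powr (1 - s)) c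
    \<le>\<^sub>L weighted_gram I (\<lambda>i. w i powr t) c \<odot> weighted_gram I (\<lambda>i. w i powr (1 - t)) c"
    (is "?G s \<le>\<^sub>L ?G t")
proof -
  have herm: "hermitian (?G p)" for p by (rule hermitian_weighted_gram_hadamard)
  have "x \<bullet> (?G s *v x) \<le> x \<bullet> (?G t *v x)" for x
  proof -
    define N where "N i j = (cmod (\<Sum>p\<in>UNIV. cnj (x $ p) * (c i $ p * c j $ p)))\<^sup>2" for i j
    have N: "N i j = N j i" "0 \<le> N i j" for i j by (simp_all add: N_def mult.commute)
    have sym: "2 * (x \<bullet> (?G p *v x))
      = (\<Sum>i\<in>I. \<Sum>j\<in>I. (w i powr p * w j powr (1 - p) + w j powr p * w i powr (1 - p)) * N i j)" for p
    proof -
      have "x \<bullet> (?G p *v x) = (\<Sum>i\<in>I. \<Sum>j\<in>I. w i powr p * w j powr (1 - p) * N i j)"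
        by (simp add: quad_form_inner[symmetric] quad_form_weighted_gram_hadamard N_def)
      moreover from this have "x \<bullet> (?G p *v x) = (\<Sum>i\<in>I. \<Sum>j\<in>I. w j powr p * w i powr (1 - p) * N i j)"
        by (subst sum.swap) (simp add: N(1))
      ultimately show ?thesis by (simp add: distrib_right sum.distrib)
    qed
    have "2 * (x \<bullet> (?G s *v x)) \<le> 2 * (x \<bullet> (?G t *v x))"
      unfolding sym
      by (intro sum_mono mult_right_mono powr_interpolation_le w N(2) st)
    then show ?thesis by simp
  qed
  moreover have "conj_transpose (?G t - ?G s) = conj_transpose (?G t) - conj_transpose (?G s)"
    by (simp add: conj_transpose_def vec_eq_iff)
  ultimately show ?thesis
    using herm[of s] herm[of t]
    by (simp add: loewner_le_def pos_semidef_def quad_form_inner hermitian_def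
        matrix_vector_mult_diff_rdistrib inner_diff_right)
qed

section \<open>Monotonicity of the Hadamard products of means\<close>

theorem corollary3p5:
  fixes A B :: "nat \<Rightarrow> complex ^ 'n ^ 'n" and m :: nat and s t :: real
  assumes "m \<ge> 1"
    and "\<And>j. j \<in> {1..m} \<Longrightarrow> pos_def (A j)"
    and "\<And>j. j \<in> {1..m} \<Longrightarrow> pos_def (B j)"
    and "(0 \<le> t \<and> t \<le> s \<and> s \<le> 1/2) \<or> (1/2 \<le> s \<and> s \<le> t \<and> t \<le> 1)"
  shows "(\<Sum>j=1..m. A j \<sharp> B j) \<odot> (\<Sum>j=1..m. A j \<sharp> B j)
           \<le>\<^sub>L (\<Sum>j=1..m. A j \<sharp>\<^bsub>s\<^esub> B j) \<odot> (\<Sum>j=1..m. A j \<sharp>\<^bsub>1 - s\<^esub> B j)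
       \<and> (\<Sum>j=1..m. A j \<sharp>\<^bsub>s\<^esub> B j) \<odot> (\<Sum>j=1..m. A j \<sharp>\<^bsub>1 - s\<^esub> B j)
           \<le>\<^sub>L (\<Sum>j=1..m. A j \<sharp>\<^bsub>t\<^esub> B j) \<odot> (\<Sum>j=1..m. A j \<sharp>\<^bsub>1 - t\<^esub> B j)
       \<and> (\<Sum>j=1..m. A j \<sharp>\<^bsub>t\<^esub> B j) \<odot> (\<Sum>j=1..m. A j \<sharp>\<^bsub>1 - t\<^esub> B j)
           \<le>\<^sub>L (\<Sum>j=1..m. A j) \<odot> (\<Sum>j=1..m. B j)"
proof -
  define decomposes where "decomposes j C d \<longleftrightarrow> (\<forall>i. 0 < d i) \<and> A j = C ** conj_transpose C
      \<and> B j = C ** real_diag d ** conj_transpose C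
      \<and> (\<forall>p. A j \<sharp>\<^bsub>p\<^esub> B j = C ** real_diag (\<lambda>i. d i powr p) ** conj_transpose C)"
    for j and C :: "complex ^ 'n ^ 'n" and d
  have "\<exists>C d. decomposes j C d" if j: "j \<in> {1..m}" for j
    unfolding decomposes_def by (rule wgeo_mean_congruence[OF assms(2,3)[OF j]]) blast
  then obtain C d where dec: "\<And>j. j \<in> {1..m} \<Longrightarrow> decomposes j (C j) (d j)" by metis
  have d: "0 < d j i" and A: "A j = C j ** conj_transpose (C j)"
    and B: "B j = C j ** real_diag (d j) ** conj_transpose (C j)"
    and mean: "A j \<sharp>\<^bsub>p\<^esub> B j = C j ** real_diag (\<lambda>i. d j i powr p) ** conj_transpose (C j)"
    if "j \<in> {1..m}" for j i p
    using dec[OF that] unfolding decomposes_def by blast+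
  define I where "I = {1..m} \<times> (UNIV :: 'n set)"
  define w where "w = (\<lambda>(j, i). d j i)"
  define c where "c = (\<lambda>(j, i). column i (C j))"
  have gram: "(\<Sum>j=1..m. A j \<sharp>\<^bsub>p\<^esub> B j) = weighted_gram I (\<lambda>i. w i powr p) c" for p
  proof -
    have "(C j ** real_diag e ** conj_transpose (C j)) $ k $ l
      = (\<Sum>i\<in>UNIV. complex_of_real (e i) * (column i (C j) $ k * cnj (column i (C j) $ l)))" for j e k l
      by (subst matrix_matrix_mult_def)
         (simp add: mult_real_diag_nth conj_transpose_def column_def ac_simps)
    then show ?thesis
      by (simp add: vec_eq_iff mean weighted_gram_def I_def w_def c_def case_prod_unfold
          sum.cartesian_product')
  qed
  have w: "0 < w i" if "i \<in> I" for i using that d by (auto simp: w_def I_def)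
  have mono: "(\<Sum>j=1..m. A j \<sharp>\<^bsub>p\<^esub> B j) \<odot> (\<Sum>j=1..m. A j \<sharp>\<^bsub>1 - p\<^esub> B j)
      \<le>\<^sub>L (\<Sum>j=1..m. A j \<sharp>\<^bsub>q\<^esub> B j) \<odot> (\<Sum>j=1..m. A j \<sharp>\<^bsub>1 - q\<^esub> B j)"
    if "0 \<le> (p - q) * (1 - p - q)" for p q
    unfolding gram by (rule weighted_gram_hadamard_mono[OF w that])
  have A0: "(\<Sum>j=1..m. A j \<sharp>\<^bsub>0\<^esub> B j) = (\<Sum>j=1..m. A j)"
  proof (rule sum.cong)
    fix j assume j: "j \<in> {1..m}"
    have powr_0: "(\<lambda>i. d j i powr 0) = (\<lambda>i. 1)" using d[OF j] by (auto simp: less_le)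
    show "A j \<sharp>\<^bsub>0\<^esub> B j = A j"
      unfolding mean[OF j] powr_0 real_diag_one by (simp add: A[OF j])
  qed simp
  have B1: "(\<Sum>j=1..m. A j \<sharp>\<^bsub>1\<^esub> B j) = (\<Sum>j=1..m. B j)"
    by (rule sum.cong) (use mean B d in \<open>simp_all add: less_imp_le\<close>)
  have "0 \<le> (1/2 - s) * (1 - 1/2 - s)" by simp
  note half_s = mono[OF this]
  have "0 \<le> (s - t) * (1 - s - t)"
    using assms(4) by (intro iffD2[OF zero_le_mult_iff]) auto
  note s_t = mono[OF this]
  \<comment> \<open>The exponent \<open>0\<close> closes the chain for \<open>t \<ge> 1/2\<close> as well: \<open>0\<close> and \<open>1\<close> are reflections of each other.\<close>
  have "0 \<le> (t - 0) * (1 - t - 0)"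
    using assms(4) by (intro iffD2[OF zero_le_mult_iff]) auto
  note t_0 = mono[OF this, unfolded diff_zero A0 B1]
  show ?thesis
    using half_s s_t t_0 by simp
qed

end
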